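(* Let $A$ be a discrete 1-form with real components $A^1_{k,s},A^2_{k,s}$. For any $f\in H^0$, a solution $\varphi\in H^0$ of the equation $$-\Delta^c_A\varphi=f$$ exists and is unique (where $\varphi$ is subject to the Dirichlet boundary conditions $\varphi_{0,s}=\varphi_{N+1,s}=0$, $\varphi_{k,0}=\varphi_{k,M+1}=0$ for all $1\le k\le N$, $1\le s\le M$).
   Context: Fix positive integers $N,M$. $H^0$ is the space of discrete 0-forms $\varphi=\sum\varphi_{k,s}x^{k,s}$ with complex components $\varphi_{k,s}$, $1\le k\le N$, $1\le s\le M$. Every $\varphi\in H^0$ is extended by the boundary conditions $\varphi_{0,s}=\varphi_{N+1,s}=0$, $\varphi_{k,0}=\varphi_{k,M+1}=0$ for $1\le k\le N$, $1\le s\le M$. The discrete magnetic Laplacian is $-\Delta^c_A=\delta^c_A d^c_A:H^0\to H^0$, where: $d^c_A\varphi=(u,v)$ is the discrete 1-form with components $u_{k,s}=\varphi_{k+1,s}-\varphi_{k,s}+i\varphi_{k,s}A^1_{k,s}$ for $0\le k\le N$, $1\le s\le M$, and $v_{k,s}=\varphi_{k,s+1}-\varphi_{k,s}+i\varphi_{k,s}A^2_{k,s}$ for $1\le k\le N$, $0\le s\le M$ (the values $A^1_{0,s},A^2_{k,0}$ are irrelevant since they multiply zero); and for a 1-form $\omega=(u,v)$, $\delta^c_A\omega$ is the 0-form with components $$(\delta^c_A\omega)_{k,s}=-(u_{k,s}-u_{k-1,s})-(v_{k,s}-v_{k,s-1})-i(A^1_{k,s}u_{k,s}+A^2_{k,s}v_{k,s}),\quad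 1\le k\le N,\ 1\le s\le M.$$ *)

theory Defs
  imports Complex_Main
begin

type_synonym form0 = "nat \<Rightarrow> nat \<Rightarrow> complex"
type_synonym form1 = "form0 \<times> form0"
type_synonym real_form1 = "(nat \<Rightarrow> nat \<Rightarrow> real) \<times> (nat \<Rightarrow> nat \<Rightarrow> real)"

text \<open>
  A 0-form is determined by its components with indices in \<open>{1..N} \<times> {1..M}\<close>. It is
  represented by the unique function on \<open>nat \<times> nat\<close> with these components that vanishes
  elsewhere, so the extension of a 0-form by the Dirichlet boundary conditions is the
  representing function itself (lemma \<open>H0_boundary\<close>), and equality of 0-forms is equality
  of functions.
\<close>

definition H0 :: "nat \<Rightarrow> nat \<Rightarrow> form0 set" where
  "H0 N M = {\<phi>. \<forall>k s. \<not> (k \<in> {1..N} \<and> s \<in> {1..M}) \<longrightarrow> \<phi> k s = 0}"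

lemma H0_boundary:
  assumes "\<phi> \<in> H0 N M"
  shows "\<phi> 0 s = 0" "\<phi> (N + 1) s = 0" "\<phi> k 0 = 0" "\<phi> k (M + 1) = 0"
  using assms by (auto simp: H0_def)

text \<open>
  The two components of a 1-form have different index ranges, \<open>{0..N} \<times> {1..M}\<close> and
  \<open>{1..N} \<times> {0..M}\<close>; outside them the components of \<open>d\<^sub>A \<phi>\<close> are set to zero.
\<close>

definition d_cov :: "nat \<Rightarrow> nat \<Rightarrow> real_form1 \<Rightarrow> form0 \<Rightarrow> form1" where
  "d_cov N M A \<phi> =
    ((\<lambda>k s. if k \<in> {0..N} \<and> s \<in> {1..M}
            then \<phi> (k + 1) s - \<phi> k s + \<i> * \<phi> k s * complex_of_real (fst A k s) else 0),
     (\<lambda>k s. if k \<in> {1..N} \<and> s \<in> {0..M}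
            then \<phi> k (s + 1) - \<phi> k s + \<i> * \<phi> k s * complex_of_real (snd A k s) else 0))"

text \<open>Below, \<open>k - 1\<close> and \<open>s - 1\<close> are only used for \<open>k, s \<ge> 1\<close>, so no truncation occurs.\<close>

definition delta_cov :: "nat \<Rightarrow> nat \<Rightarrow> real_form1 \<Rightarrow> form1 \<Rightarrow> form0" where
  "delta_cov N M A \<omega> = (case \<omega> of (u, v) \<Rightarrow>
    (\<lambda>k s. if k \<in> {1..N} \<and> s \<in> {1..M}
           then - (u k s - u (k - 1) s) - (v k s - v k (s - 1))
                - \<i> * (complex_of_real (fst A k s) * u k s + complex_of_real (snd A k s) * v k s)
           else 0))"

definition neg_magnetic_laplacian :: "nat \<Rightarrow> nat \<Rightarrow> real_form1 \<Rightarrow> form0 \<Rightarrow> form0" where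
  "neg_magnetic_laplacian N M A \<phi> = delta_cov N M A (d_cov N M A \<phi>)"

lemma neg_magnetic_laplacian_in_H0: "neg_magnetic_laplacian N M A \<phi> \<in> H0 N M"
  by (auto simp: neg_magnetic_laplacian_def delta_cov_def H0_def split: prod.splits)

end

theory Submission
  imports Defs "HOL-Library.Function_Algebras"
begin

text \<open>
  The operators \<open>delta_cov\<close> and \<open>d_cov\<close> are adjoint to each other (summation by parts, where the
  Dirichlet conditions remove the boundary terms and the reality of \<open>A\<close> moves \<open>\<i> A\<close> across
  the inner product). Hence a form \<open>\<phi>\<close> in the kernel of the Laplacian satisfies
  \<open>d_cov N M A \<phi> = 0\<close>, that is \<open>\<phi> (k + 1) s = (1 - \<i> A\<^sup>1) \<phi> k s\<close>, and \<open>\<phi>\<close> vanishes because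
  it vanishes at \<open>k = 0\<close>. An injective endomorphism of the finite-dimensional space \<open>H0 N M\<close>
  is bijective.
\<close>

text \<open>Injectivity sends a basis of \<open>V\<close> to an independent subset of
  \<open>V\<close> of the same size, which must again span \<open>V\<close>. The statement concerns
  a subspace with a finite spanning set because the full type \<open>form0\<close> is
  infinite-dimensional.\<close>

lemma (in vector_space) linear_inj_on_imp_image_eq:
  assumes lin: "Vector_Spaces.linear scale scale f" and V: "subspace V"
    and T: "finite T" "V \<subseteq> span T" and f: "f ` V \<subseteq> V" "inj_on f V"
  shows "f ` V = V"
proof -
  interpret pr: vector_space_pair scale scale ..
  obtain B where B: "B \<subseteq> V" "independent B" "V \<subseteq> span B"
    using maximal_independent_subset by blast
  have span: "span B = V"
    using B V by (simp add: span_minimal subset_antisym)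
  have finB: "finite B"
    using independent_span_bound[OF T(1) B(2)] B(1) T(2) by blast
  have ind: "independent (f ` B)"
    using pr.linear_independent_injective_image[OF lin B(2)] f(2) span by simp
  have "V \<subseteq> span (f ` B)"
  proof
    fix y assume y: "y \<in> V"
    show "y \<in> span (f ` B)"
    proof (rule ccontr)
      assume ny: "y \<notin> span (f ` B)"
      \<comment> \<open>Adjoining \<open>y\<close> would give \<open>card B + 1\<close> independent
        vectors inside \<open>span B\<close>, against the exchange bound.\<close>
      have "insert y (f ` B) \<subseteq> span B"
        using y B(1) f(1) span by auto
      then have "card (insert y (f ` B)) \<le> card B"
        using independent_span_bound[OF finB independent_insertI[OF ny ind]] by blast
      moreover have "card (f ` B) = card B"
        using f(2) B(1) by (meson card_image inj_on_subset)
      moreover have "y \<notin> f ` B"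
        using ny span_base by blast
      ultimately show False
        using finB by simp
    qed
  qed
  moreover have "span (f ` B) = f ` V"
    using pr.linear_span_image[OF lin, of B] span by simp
  ultimately show ?thesis
    using f(1) by blast
qed

definition scale_form :: "complex \<Rightarrow> form0 \<Rightarrow> form0" where
  "scale_form c \<phi> = (\<lambda>k s. c * \<phi> k s)"

interpretation form: vector_space scale_form
  by unfold_locales (auto simp: scale_form_def fun_eq_iff algebra_simps)

lemma sum_form_apply: "(\<Sum>i\<in>I. (g i :: form0)) k s = (\<Sum>i\<in>I. g i k s)"
  by (induction I rule: infinite_finite_induct) auto

definition unit_form :: "nat \<times> nat \<Rightarrow> form0" where
  "unit_form p = (\<lambda>k s. if p = (k, s) then 1 else 0)"

lemma H0_subspace: "form.subspace (H0 N M)"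
  by (auto simp: form.subspace_def H0_def scale_form_def)

text \<open>This supplies the finite-dimensionality of \<open>H0 N M\<close>: each form is expanded
  in the unit forms with its own components as coefficients.\<close>

lemma H0_subset_span: "H0 N M \<subseteq> form.span (unit_form ` ({1..N} \<times> {1..M}))"
proof
  fix \<phi> assume \<phi>: "\<phi> \<in> H0 N M"
  have "\<phi> = (\<Sum>p\<in>{1..N} \<times> {1..M}. scale_form (\<phi> (fst p) (snd p)) (unit_form p))"
  proof (intro ext)
    fix k s
    have "(\<Sum>p\<in>{1..N} \<times> {1..M}. scale_form (\<phi> (fst p) (snd p)) (unit_form p)) k s
        = (\<Sum>p\<in>{1..N} \<times> {1..M}. if p = (k, s) then \<phi> k s else 0)"
      unfolding sum_form_apply
      by (intro sum.cong) (auto simp: scale_form_def unit_form_def)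
    also have "\<dots> = \<phi> k s"
      using \<phi> by (auto simp: H0_def)
    finally show "\<phi> k s =
        (\<Sum>p\<in>{1..N} \<times> {1..M}. scale_form (\<phi> (fst p) (snd p)) (unit_form p)) k s" ..
  qed
  also have "\<dots> \<in> form.span (unit_form ` ({1..N} \<times> {1..M}))"
    by (intro form.span_sum form.span_scale form.span_base) auto
  finally show "\<phi> \<in> form.span (unit_form ` ({1..N} \<times> {1..M}))" .
qed

lemma linear_neg_magnetic_laplacian:
  "Vector_Spaces.linear scale_form scale_form (neg_magnetic_laplacian N M A)"
proof unfold_locales
  fix \<phi> \<psi> :: form0 and c :: complex
  show "neg_magnetic_laplacian N M A (\<phi> + \<psi>)
      = neg_magnetic_laplacian N M A \<phi> + neg_magnetic_laplacian N M A \<psi>"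
    by (auto simp: neg_magnetic_laplacian_def delta_cov_def d_cov_def fun_eq_iff algebra_simps)
  show "neg_magnetic_laplacian N M A (scale_form c \<phi>)
      = scale_form c (neg_magnetic_laplacian N M A \<phi>)"
    by (auto simp: neg_magnetic_laplacian_def delta_cov_def d_cov_def scale_form_def
        fun_eq_iff algebra_simps)
qed

text \<open>The boundary term at \<open>n + 1\<close> is kept so that induction on \<open>n\<close>
  goes through; \<open>g 0 = 0\<close> removes the lower one together with \<open>a 0\<close>. The
  sign of the term in \<open>a\<close> comes from \<open>cnj (\<i> * a) = - \<i> * a\<close> for
  real \<open>a\<close>.\<close>

lemma cov_summation_by_parts:
  fixes g u :: "nat \<Rightarrow> complex" and a :: "nat \<Rightarrow> real"
  assumes "g 0 = 0"
  shows "(\<Sum>k=1..n. cnj (g k) * (- (u k - u (k - 1)) - \<i> * (of_real (a k) * u k)))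
      + cnj (g (n + 1)) * u n
    = (\<Sum>k=0..n. cnj (g (k + 1) - g k + \<i> * g k * of_real (a k)) * u k)"
proof (induction n)
  case 0
  then show ?case using assms by simp
next
  case (Suc n)
  then show ?case by (simp add: algebra_simps)
qed

lemma delta_cov_adjoint:
  assumes \<phi>: "\<phi> \<in> H0 N M"
  shows "(\<Sum>k=1..N. \<Sum>s=1..M. cnj (\<phi> k s) * delta_cov N M A \<omega> k s)
    = (\<Sum>k=0..N. \<Sum>s=1..M. cnj (fst (d_cov N M A \<phi>) k s) * fst \<omega> k s)
      + (\<Sum>k=1..N. \<Sum>s=0..M. cnj (snd (d_cov N M A \<phi>) k s) * snd \<omega> k s)"
proof -
  obtain u v where \<omega>: "\<omega> = (u, v)" by (cases \<omega>)
  note bd = H0_boundary[OF \<phi>]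
  let ?U = "\<lambda>k s. cnj (\<phi> k s) * (- (u k s - u (k - 1) s) - \<i> * (of_real (fst A k s) * u k s))"
  let ?V = "\<lambda>k s. cnj (\<phi> k s) * (- (v k s - v k (s - 1)) - \<i> * (of_real (snd A k s) * v k s))"
  have "(\<Sum>k=1..N. \<Sum>s=1..M. cnj (\<phi> k s) * delta_cov N M A \<omega> k s)
      = (\<Sum>k=1..N. \<Sum>s=1..M. ?U k s + ?V k s)"
    by (intro sum.cong refl) (simp add: \<omega> delta_cov_def algebra_simps)
  \<comment> \<open>The differences of \<open>u\<close> run in \<open>k\<close>, so this part is
    summed over \<open>k\<close> first, to apply the one-dimensional identity for each fixed
    \<open>s\<close>.\<close>
  also have "\<dots> = (\<Sum>s=1..M. \<Sum>k=1..N. ?U k s) + (\<Sum>k=1..N. \<Sum>s=1..M. ?V k s)"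
    unfolding sum.distrib by (simp only: sum.swap[of ?U])
  also have "(\<Sum>s=1..M. \<Sum>k=1..N. ?U k s)
      = (\<Sum>s=1..M. \<Sum>k=0..N. cnj (fst (d_cov N M A \<phi>) k s) * u k s)"
  proof (rule sum.cong[OF refl])
    fix s assume "s \<in> {1..M}"
    then show "(\<Sum>k=1..N. ?U k s) = (\<Sum>k=0..N. cnj (fst (d_cov N M A \<phi>) k s) * u k s)"
      \<comment> \<open>The boundary term vanishes because
        \<open>\<phi> (N + 1) s = 0\<close>.\<close>
      using cov_summation_by_parts[of "\<lambda>k. \<phi> k s" "\<lambda>k. u k s" "\<lambda>k. fst A k s" N] bd
      by (simp add: d_cov_def)
  qed
  also have "\<dots> = (\<Sum>k=0..N. \<Sum>s=1..M. cnj (fst (d_cov N M A \<phi>) k s) * u k s)"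
    by (rule sum.swap)
  also have "(\<Sum>k=1..N. \<Sum>s=1..M. ?V k s)
      = (\<Sum>k=1..N. \<Sum>s=0..M. cnj (snd (d_cov N M A \<phi>) k s) * v k s)"
  proof (rule sum.cong[OF refl])
    fix k assume "k \<in> {1..N}"
    then show "(\<Sum>s=1..M. ?V k s) = (\<Sum>s=0..M. cnj (snd (d_cov N M A \<phi>) k s) * v k s)"
      using cov_summation_by_parts[of "\<lambda>s. \<phi> k s" "\<lambda>s. v k s" "\<lambda>s. snd A k s" M] bd
      by (simp add: d_cov_def)
  qed
  finally show ?thesis by (simp add: \<omega>)
qed

lemma neg_magnetic_laplacian_eq_0D:
  assumes \<phi>: "\<phi> \<in> H0 N M" and L: "neg_magnetic_laplacian N M A \<phi> = 0"
  shows "\<phi> = 0"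
proof -
  let ?u = "fst (d_cov N M A \<phi>)" and ?v = "snd (d_cov N M A \<phi>)"
  \<comment> \<open>Adjointness with \<open>\<omega> = d_cov N M A \<phi>\<close> turns the pairing
    of \<open>\<phi>\<close> with its Laplacian into the squared norm of
    \<open>d_cov N M A \<phi>\<close>.\<close>
  have "(\<Sum>k=0..N. \<Sum>s=1..M. cnj (?u k s) * ?u k s) + (\<Sum>k=1..N. \<Sum>s=0..M. cnj (?v k s) * ?v k s) = 0"
    using delta_cov_adjoint[OF \<phi>, of A "d_cov N M A \<phi>"] L
    by (simp add: neg_magnetic_laplacian_def)
  moreover have norm_sq: "cnj z * z = of_real ((cmod z)\<^sup>2)" for z
    by (metis complex_norm_square mult.commute)
  \<comment> \<open>The identity is moved to the reals, where nonnegativity forces each summand to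
    be zero.\<close>
  ultimately have "complex_of_real ((\<Sum>k=0..N. \<Sum>s=1..M. (cmod (?u k s))\<^sup>2)
      + (\<Sum>k=1..N. \<Sum>s=0..M. (cmod (?v k s))\<^sup>2)) = 0"
    by (simp only: norm_sq of_real_sum of_real_add)
  then have "(\<Sum>k=0..N. \<Sum>s=1..M. (cmod (?u k s))\<^sup>2)
      + (\<Sum>k=1..N. \<Sum>s=0..M. (cmod (?v k s))\<^sup>2) = 0"
    by (simp only: of_real_eq_0_iff)
  moreover have "(\<Sum>k=0..N. \<Sum>s=1..M. (cmod (?u k s))\<^sup>2) \<ge> 0"
    "(\<Sum>k=1..N. \<Sum>s=0..M. (cmod (?v k s))\<^sup>2) \<ge> 0"
    by (intro sum_nonneg zero_le_power2)+
  ultimately have "(\<Sum>k=0..N. \<Sum>s=1..M. (cmod (?u k s))\<^sup>2) = 0"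
    by linarith
  then have u0: "?u k s = 0" if "k \<le> N" "s \<in> {1..M}" for k s
    using that by (simp add: sum_nonneg_eq_0_iff sum_nonneg)
  have "\<phi> k s = 0" if "k \<le> N" "s \<in> {1..M}" for k s
    using that(1)
  proof (induction k)
    case 0
    then show ?case using H0_boundary[OF \<phi>] by simp
  next
    case (Suc k)
    \<comment> \<open>Vanishing of \<open>?u k s\<close> expresses \<open>\<phi> (Suc k) s\<close>
      as a multiple of \<open>\<phi> k s\<close>, which is zero by induction.\<close>
    then show ?case using u0[of k s] that(2) by (simp add: d_cov_def)
  qed
  then show ?thesis
    using \<phi> by (auto simp: H0_def fun_eq_iff)
qed

theorem theorem3p4:
  fixes N M :: nat and A :: real_form1 and f :: form0
  assumes "N \<ge> 1" and "M \<ge> 1" and "f \<in> H0 N M"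
  shows "\<exists>!\<phi>. \<phi> \<in> H0 N M \<and> neg_magnetic_laplacian N M A \<phi> = f"
proof -
  let ?L = "neg_magnetic_laplacian N M A"
  interpret vector_space_pair scale_form scale_form ..
  have inj: "inj_on ?L (H0 N M)"
    using linear_inj_on_iff_eq_0[OF linear_neg_magnetic_laplacian H0_subspace]
      neg_magnetic_laplacian_eq_0D by blast
  have "?L ` H0 N M = H0 N M"
    using form.linear_inj_on_imp_image_eq[OF linear_neg_magnetic_laplacian H0_subspace
        _ H0_subset_span _ inj] neg_magnetic_laplacian_in_H0 by blast
  then show ?thesis
    using inj assms(3) by (auto simp: inj_on_def image_iff set_eq_iff) metis
qed

end
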